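(* Let $\mu$ be a stationary ergodic and elliptic probability measure on $\Omega$. Then $\mathbb P_0(A^+\cup A^-)\in\{0,1\}$.
   Context: Notation: $\mathbb N=\{1,2,\dots\}$. A cookie environment is $\omega\in\Omega=[0,1]^{\mathbb Z\times\mathbb N}$ (with the product Borel $\sigma$-algebra); $\omega(x,n)$ is the $n$-th cookie at site $x$. The shift $\theta$ acts by $(\theta\omega)(x,n)=\omega(x+1,n)$. A probability measure $\mu$ on $\Omega$ is stationary ergodic if it is $\theta$-invariant and ergodic for $\theta$, and elliptic if $\mu((0,1)^{\mathbb Z\times\mathbb N})=1$. For $\omega\in\Omega$ and $x\in\mathbb Z$, the excited random walk under $P_{\omega,x}$ is the process $(X_n)_{n\ge0}$ with $X_0=x$ and, conditionally on $X_0,\dots,X_{n-1}$, $X_n=X_{n-1}+1$ with probability $\omega(X_{n-1},\#\{k\le n-1:X_k=X_{n-1}\})$ and $X_n=X_{n-1}-1$ otherwise. The annealed law is $\mathbb P_x(\cdot)=\int_\Omega P_{\omega,x}(\cdot)\,d\mu(\omega)$. $A^+=\{\lim X_n=+\infty\}$, $A^-=\{\lim X_n=-\infty\}$. *)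

theory Defs
  imports "HOL-Probability.Probability"
begin

text \<open>Cookie environments: \<open>\<omega> (x, n)\<close> is the n-th cookie at site x; only n \<ge> 1 is
  used (the coordinate n = 0 is an unused dummy). The space is \<open>[0,1]^(\<int> \<times> \<nat>)\<close>
  with the product Borel sigma-algebra.\<close>

type_synonym env = "int \<times> nat \<Rightarrow> real"

definition cookie_space :: "env measure" where
  "cookie_space = PiM UNIV (\<lambda>_. restrict_space borel {0..1::real})"

definition shift :: "env \<Rightarrow> env" where
  "shift \<omega> = (\<lambda>(x, n). \<omega> (x + 1, n))"

definition stationary :: "env measure \<Rightarrow> bool" where
  "stationary \<mu> \<longleftrightarrow> distr \<mu> cookie_space shift = \<mu>"

definition ergodic :: "env measure \<Rightarrow> bool" where
  "ergodic \<mu> \<longleftrightarrow> (\<forall>A \<in> sets \<mu>. shift -` A \<inter> space \<mu> = A \<longrightarrow>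
      measure \<mu> A = 0 \<or> measure \<mu> A = 1)"

definition elliptic :: "env measure \<Rightarrow> bool" where
  "elliptic \<mu> \<longleftrightarrow> measure \<mu> {\<omega> \<in> space \<mu>. \<forall>x n. n \<ge> 1 \<longrightarrow> \<omega> (x, n) \<in> {0<..<1}} = 1"

text \<open>Excited random walk driven by an i.i.d. uniform sequence \<open>U\<close>:
  \<open>traj \<omega> x U n = [X_0, ..., X_n]\<close>; at step n+1 the walk at \<open>y = X_n\<close>, visited
  \<open>k = #{j \<le> n. X_j = y}\<close> times, steps up iff \<open>U n < \<omega> (y, k)\<close>, which has
  probability \<open>\<omega> (y, k)\<close> independently of the past.\<close>

fun traj :: "env \<Rightarrow> int \<Rightarrow> (nat \<Rightarrow> real) \<Rightarrow> nat \<Rightarrow> int list" where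
  "traj \<omega> x U 0 = [x]"
| "traj \<omega> x U (Suc n) =
     (let xs = traj \<omega> x U n; y = last xs; k = count_list xs y
      in xs @ [if U n < \<omega> (y, k) then y + 1 else y - 1])"

definition walk :: "env \<Rightarrow> int \<Rightarrow> (nat \<Rightarrow> real) \<Rightarrow> nat \<Rightarrow> int" where
  "walk \<omega> x U n = last (traj \<omega> x U n)"

definition unif_seq :: "(nat \<Rightarrow> real) measure" where
  "unif_seq = PiM UNIV (\<lambda>_. uniform_measure lborel {0..1::real})"

definition path_space :: "(nat \<Rightarrow> int) measure" where
  "path_space = PiM UNIV (\<lambda>_. count_space UNIV)"

definition quenched :: "env \<Rightarrow> int \<Rightarrow> (nat \<Rightarrow> int) measure" where
  "quenched \<omega> x = distr unif_seq path_space (walk \<omega> x)"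

definition annealed :: "env measure \<Rightarrow> int \<Rightarrow> (nat \<Rightarrow> int) measure" where
  "annealed \<mu> x = bind \<mu> (\<lambda>\<omega>. quenched \<omega> x)"

definition A_plus :: "(nat \<Rightarrow> int) set" where
  "A_plus = {X. filterlim X at_top sequentially}"

definition A_minus :: "(nat \<Rightarrow> int) set" where
  "A_minus = {X. filterlim X at_bot sequentially}"

end

theory Submission
  imports Defs
begin

text \<open>Attach to every site x an independent uniform variable for each visit and let the arrow
  \<open>(x, n)\<close> point up iff the n-th variable at x is below \<open>\<omega> (x, n)\<close>; following the arrows gives a walk
  with the quenched law. Suppose that it escapes to \<open>+\<infinity>\<close> with positive probability.

  If some site had only finitely many up arrows with positive probability, then by ellipticity all
  arrows at a site would point down with positive probability, hence by recurrence (ergodicity for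
  the environment, Kolmogorov's 0-1 law for the uniform variables) infinitely many sites to the right
  would be impassable from the left. So every site has infinitely many up arrows, and a walk that is
  bounded above tends to \<open>-\<infinity>\<close>. On the other hand, by ellipticity the walk escapes without ever
  going below 0 with positive probability. As this depends only on the arrows at sites \<open>\<ge> 0\<close>, by
  recurrence it happens from infinitely many sites on the right, and a walk that is unbounded above
  escapes at the first of them that it hits. Hence almost surely the walk is transient; escape
  to \<open>-\<infinity>\<close> is treated by reflection.\<close>

subsection \<open>Walks following arrows\<close>

text \<open>The recursion of \<open>traj\<close>, with the randomness attached to site and visit
  number instead of time, so that the behaviour on a half line is governed by the arrows there.
  Other starting points are reached through \<open>translate\<close>.\<close>

fun arrow_traj :: "(int \<times> nat \<Rightarrow> bool) \<Rightarrow> nat \<Rightarrow> int list" where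
  "arrow_traj a 0 = [0]"
| "arrow_traj a (Suc n) =
     (let xs = arrow_traj a n; y = last xs; k = count_list xs y
      in xs @ [if a (y, k) then y + 1 else y - 1])"

definition pos :: "(int \<times> nat \<Rightarrow> bool) \<Rightarrow> nat \<Rightarrow> int" where
  "pos a n = last (arrow_traj a n)"

definition visits :: "(int \<times> nat \<Rightarrow> bool) \<Rightarrow> nat \<Rightarrow> int \<Rightarrow> nat" where
  "visits a n y = count_list (arrow_traj a n) y"

definition escapes :: "(int \<times> nat \<Rightarrow> bool) \<Rightarrow> bool" where
  "escapes a \<longleftrightarrow> filterlim (pos a) at_top sequentially"

definition translate :: "int \<Rightarrow> (int \<times> nat \<Rightarrow> 'a) \<Rightarrow> int \<times> nat \<Rightarrow> 'a" where
  "translate j a = (\<lambda>(x, n). a (x + j, n))"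

text \<open>The identity for \<open>s = 1\<close>; for \<open>s = -1\<close> the mirror image, with
  sites reflected and arrows reversed. One argument then covers both directions of escape.\<close>

definition orient :: "int \<Rightarrow> (int \<times> nat \<Rightarrow> bool) \<Rightarrow> int \<times> nat \<Rightarrow> bool" where
  "orient s a = (\<lambda>(x, n). a (s * x, n) = (s = 1))"

section \<open>Positions and visit counts\<close>

lemma pos_0 [simp]: "pos a 0 = 0"
  by (simp add: pos_def)

lemma visits_0: "visits a 0 y = (if y = 0 then 1 else 0)"
  by (simp add: visits_def)

lemma pos_Suc: "pos a (Suc n) = (if a (pos a n, visits a n (pos a n)) then pos a n + 1 else pos a n - 1)"
  by (simp add: pos_def visits_def Let_def)

lemma visits_Suc: "visits a (Suc n) y = visits a n y + (if pos a (Suc n) = y then 1 else 0)"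
  by (simp add: pos_def visits_def Let_def)

lemma visits_mono: "m \<le> n \<Longrightarrow> visits a m y \<le> visits a n y"
  by (induction n rule: dec_induct) (auto simp: visits_Suc)

lemma visits_pos: "visits a n (pos a n) \<ge> 1"
  by (cases n) (auto simp: visits_0 visits_Suc)

lemma visits_eq_0: "(\<And>k. k \<le> n \<Longrightarrow> pos a k \<noteq> y) \<Longrightarrow> visits a n y = 0"
proof (induction n)
  case 0
  then show ?case using 0[of 0] by (auto simp: visits_0)
next
  case (Suc n)
  then show ?case using Suc.prems[of "Suc n"] by (simp add: visits_Suc)
qed

lemma visits_unbounded:
  assumes "\<exists>\<^sub>F n in sequentially. pos a n = y"
  shows "\<exists>n. visits a n y \<ge> k"
proof (induction k)
  case (Suc k)
  then obtain n where "visits a n y \<ge> k" by auto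
  moreover obtain m where "m \<ge> Suc n" "pos a m = y"
    using assms by (auto simp: frequently_sequentially)
  ultimately have "visits a m y \<ge> Suc k"
    using visits_mono[of n "m - 1" a y] visits_Suc[of a "m - 1" y] by (cases m) auto
  then show ?case by blast
qed auto

text \<open>Visit counts grow in steps of one and are unbounded at a recurrent site, so no value is
  skipped. The count includes the present visit, hence \<open>k \<ge> 1\<close>.\<close>

lemma arrow_used:
  assumes "\<exists>\<^sub>F n in sequentially. pos a n = y" "k \<ge> 1"
  shows "\<exists>n. pos a n = y \<and> visits a n y = k"
proof -
  define n where "n = (LEAST n. visits a n y \<ge> k)"
  have n: "visits a n y \<ge> k"
    unfolding n_def using visits_unbounded[OF assms(1), of k] by (rule LeastI_ex)
  have less: "visits a m y < k" if "m < n" for m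
    using not_less_Least[of m "\<lambda>n. visits a n y \<ge> k"] that unfolding n_def by auto
  show ?thesis
  proof (cases n)
    case 0
    then show ?thesis using n assms(2) by (auto simp: visits_0 split: if_splits intro!: exI[of _ 0])
  next
    case (Suc m)
    then have "pos a n = y \<and> visits a n y = k"
      using n less[of m] by (auto simp: visits_Suc split: if_splits)
    then show ?thesis by blast
  qed
qed

lemma pos_orient_minus: "pos (orient (-1) a) n = - pos a n"
proof -
  have "pos (orient (-1) a) n = - pos a n \<and> (\<forall>y. visits (orient (-1) a) n y = visits a n (- y))"
  proof (induction n)
    case 0
    then show ?case by (auto simp: visits_0)
  next
    case (Suc n)
    then have "pos (orient (-1) a) (Suc n) = - pos a (Suc n)"
      by (simp add: pos_Suc) (simp add: orient_def)
    with Suc show ?case by (auto simp: visits_Suc)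
  qed
  then show ?thesis ..
qed

section \<open>Barriers and walks bounded above\<close>

lemma pos_le_barrier:
  assumes "j \<ge> 0" and "\<And>n. n \<ge> 1 \<Longrightarrow> \<not> a (j, n)"
  shows "pos a n \<le> j"
proof (induction n)
  case (Suc n)
  then show ?case using assms(2)[OF visits_pos[of a n]] by (cases "pos a n = j") (auto simp: pos_Suc)
qed (use assms in auto)

lemma not_escapes_bounded:
  assumes "\<And>n. pos a n \<le> K"
  shows "\<not> escapes a"
proof
  assume "escapes a"
  then have "eventually (\<lambda>n. pos a n \<ge> K + 1) sequentially"
    unfolding escapes_def by (simp add: filterlim_at_top)
  then show False using assms by (auto simp: eventually_sequentially) (metis add_le_same_cancel1 not_one_le_zero order.trans linorder_not_le order_refl zless_add1_eq)
qed

text \<open>Descending induction over the levels: were a level visited infinitely often, its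
  infinitely many up arrows would all be read, and the level above would be visited infinitely often
  too.\<close>

lemma bounded_imp_escapes_minus:
  assumes arrows: "\<And>y k. \<exists>n>k. a (y, n)" and bdd: "\<And>n. pos a n \<le> K"
  shows "escapes (orient (-1) a)"
proof -
  have fin: "eventually (\<lambda>n. pos a n \<noteq> K + 1 - int i) sequentially" for i
  proof (induction i)
    case 0
    then show ?case using bdd by (intro always_eventually) (auto, smt (verit) bdd)
  next
    case (Suc i)
    define y where "y = K - int i"
    have y: "eventually (\<lambda>n. pos a n \<noteq> y + 1) sequentially"
      using Suc by (simp add: y_def algebra_simps)
    have "eventually (\<lambda>n. pos a n \<noteq> y) sequentially"
    proof (rule ccontr)
      assume "\<not> ?thesis"
      then have freq: "\<exists>\<^sub>F n in sequentially. pos a n = y" by (simp add: frequently_def)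
      obtain N where N: "\<And>n. n \<ge> N \<Longrightarrow> pos a n \<noteq> y + 1"
        using y by (auto simp: eventually_sequentially)
      \<comment> \<open>An up arrow not yet read by time \<open>N\<close>: reading it later leads to
        \<open>y + 1\<close> after time \<open>N\<close>.\<close>
      obtain k where k: "k > visits a N y" "a (y, k)" using arrows by blast
      obtain n where n: "pos a n = y" "visits a n y = k" using arrow_used[OF freq, of k] k by auto
      then have "n > N" using visits_mono[of n N a y] k by (cases "n \<le> N") auto
      moreover have "pos a (Suc n) = y + 1" using n k by (simp add: pos_Suc)
      ultimately show False using N[of "Suc n"] by simp
    qed
    then show ?case by (simp add: y_def algebra_simps)
  qed
  show ?thesis
    unfolding escapes_def filterlim_at_top
  proof
    fix Z
    \<comment> \<open>The indices run through the levels from \<open>K + 1\<close> down to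
      \<open>- Z\<close>.\<close>
    have "eventually (\<lambda>n. \<forall>i\<in>{..nat (K + 1 + Z)}. pos a n \<noteq> K + 1 - int i) sequentially"
      using fin by (intro eventually_ball_finite) auto
    then show "eventually (\<lambda>n. Z \<le> pos (orient (-1) a) n) sequentially"
    proof eventually_elim
      case (elim n)
      show ?case
      proof (rule ccontr)
        assume "\<not> ?thesis"
        then have "pos a n > - Z" by (simp add: pos_orient_minus)
        then show False
          using elim[rule_format, of "nat (K + 1 - pos a n)"] bdd[of n] by (auto simp: nat_mono)
      qed
    qed
  qed
qed

text \<open>When \<open>x\<close> is first hit, no site above \<open>x\<close> has been visited and
  \<open>x\<close> counts one visit, so the visit numbers from \<open>x\<close> upwards start
  afresh. Agreement is asked only for the arrows that \<open>b\<close> reads, which allows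
  comparison with a field altered elsewhere.\<close>

lemma pos_after_first_hit:
  assumes "\<And>k. k < T \<Longrightarrow> pos a k < x" and "pos a T = x"
    and nonneg: "\<And>n. pos b n \<ge> 0"
    and agree: "\<And>n. b (pos b n, visits b n (pos b n)) = a (x + pos b n, visits b n (pos b n))"
  shows "pos a (T + n) = x + pos b n"
proof -
  have "pos a (T + n) = x + pos b n \<and> (\<forall>y\<ge>0. visits a (T + n) (x + y) = visits b n y)"
  proof (induction n)
    case 0
    have "visits a T (x + y) = (if y = 0 then 1 else 0)" if "y \<ge> 0" for y
    proof (cases T)
      case 0
      then show ?thesis using assms(2) by (auto simp: visits_0)
    next
      case (Suc m)
      moreover have "visits a m (x + y) = 0"
        using that assms(1) Suc by (intro visits_eq_0) (metis add.commute add_increasing less_Suc_eq_le not_less order_refl)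
      ultimately show ?thesis using assms(2) by (auto simp: visits_Suc)
    qed
    then show ?case using assms(2) by (simp add: visits_0)
  next
    case (Suc n)
    have "pos a (T + Suc n) = x + pos b (Suc n)"
      using Suc agree[of n] nonneg[of n] by (simp add: pos_Suc)
    with Suc show ?case by (simp add: visits_Suc)
  qed
  then show ?thesis by blast
qed

section \<open>Escape within the right half line\<close>

definition positive_escape :: "(int \<times> nat \<Rightarrow> bool) \<Rightarrow> bool" where
  "positive_escape a \<longleftrightarrow> escapes a \<and> (\<forall>n. pos a n \<ge> 0)"

lemma positive_escape_cong:
  assumes "positive_escape b" and "\<And>x n. x \<ge> 0 \<Longrightarrow> a (x, n) = b (x, n)"
  shows "positive_escape a"
proof -
  \<comment> \<open>The trivial first hit: \<open>T = 0\<close> and \<open>x = 0\<close>.\<close>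
  have "pos a (0 + n) = 0 + pos b n" for n
    using assms by (intro pos_after_first_hit) (auto simp: positive_escape_def)
  then have "pos a = pos b" by auto
  with assms(1) show ?thesis by (simp add: positive_escape_def escapes_def)
qed

lemma first_hit:
  assumes "x \<ge> 0" "pos a n \<ge> x"
  obtains T where "pos a T = x" "\<And>k. k < T \<Longrightarrow> pos a k < x"
proof -
  define T where "T = (LEAST n. pos a n \<ge> x)"
  have T: "pos a T \<ge> x" unfolding T_def using assms(2) by (rule LeastI)
  have less: "pos a k < x" if "k < T" for k
    using not_less_Least[of k "\<lambda>n. pos a n \<ge> x"] that unfolding T_def by auto
  have "pos a T = x"
  proof (cases T)
    case 0
    then show ?thesis using T assms(1) by simp
  next
    case (Suc m)
    then show ?thesis using T less[of m] by (auto simp: pos_Suc split: if_splits)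
  qed
  then show thesis using less that by blast
qed

text \<open>From the first hit of \<open>x\<close> on, the walk copies the walk in the translated
  field, whatever it did before.\<close>

lemma escapes_from_hit:
  assumes "x \<ge> 0" "pos a n \<ge> x" "positive_escape (translate x a)"
  shows "escapes a"
proof -
  let ?b = "translate x a"
  obtain T where T: "pos a T = x" "\<And>k. k < T \<Longrightarrow> pos a k < x"
    using first_hit assms by metis
  have "pos a (T + n) = x + pos ?b n" for n
    using T assms(3) by (intro pos_after_first_hit) (auto simp: positive_escape_def translate_def add.commute)
  then have shifted: "pos a n = x + pos ?b (n - T)" if "n \<ge> T" for n
    by (metis le_add_diff_inverse that)
  show ?thesis
    unfolding escapes_def filterlim_at_top
  proof
    fix Z
    have "eventually (\<lambda>n. Z - x \<le> pos ?b n) sequentially"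
      using assms(3) by (auto simp: positive_escape_def escapes_def filterlim_at_top)
    then obtain L where "\<And>n. n \<ge> L \<Longrightarrow> Z - x \<le> pos ?b n"
      by (auto simp: eventually_sequentially)
    then have "Z \<le> pos a n" if "n \<ge> L + T" for n
      using shifted[of n] that by (auto simp: algebra_simps)
    then show "eventually (\<lambda>n. Z \<le> pos a n) sequentially"
      by (auto simp: eventually_sequentially)
  qed
qed

text \<open>Deleting the excursions of the walk below 0 turns it into the walk reflected at 0, which
  is the walk in the environment where all arrows at 0 point up.\<close>

lemma escapes_imp_positive_escape:
  assumes "escapes a"
  shows "\<exists>k. positive_escape (\<lambda>(x, n). if x = 0 \<and> n \<in> {1..k} then True else a (x, n))"
proof -
  define b where "b = (\<lambda>(x::int, n::nat). x = 0 \<or> a (x, n))"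
  have b_nonneg: "pos b n \<ge> 0" for n
    by (induction n) (auto simp: pos_Suc b_def)
  \<comment> \<open>\<open>m n\<close> counts the steps before time \<open>n\<close> that survive
    the deletion: those from sites at least 1 and those from 0 to 1.\<close>
  define m where "m = rec_nat 0 (\<lambda>n i. if pos a n \<ge> 1 \<or> (pos a n = 0 \<and> pos a (Suc n) = 1) then Suc i else i)"
  have m_0: "m 0 = 0" by (simp add: m_def)
  have m_Suc: "m (Suc n) = (if pos a n \<ge> 1 \<or> (pos a n = 0 \<and> pos a (Suc n) = 1) then Suc (m n) else m n)" for n
    by (simp add: m_def)
  \<comment> \<open>Visit counts at 0 may differ, because excursions below 0 add visits there; this
    is harmless, as every arrow of \<open>b\<close> at 0 points up.\<close>
  have inv: "pos b (m n) = max (pos a n) 0 \<and> (\<forall>y\<ge>1. visits b (m n) y = visits a n y)" for n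
  proof (induction n)
    case 0
    then show ?case by (simp add: m_0 visits_0)
  next
    case (Suc n)
    have b0: "b (0, k)" for k by (simp add: b_def)
    have b1: "b (y, k) = a (y, k)" if "y \<ge> 1" for y k using that by (auto simp: b_def)
    have "pos a (Suc n) = pos a n + 1 \<or> pos a (Suc n) = pos a n - 1" by (simp add: pos_Suc)
    then consider "pos a n \<ge> 1" | "pos a n = 0" "pos a (Suc n) = 1" | "pos a n = 0" "pos a (Suc n) = -1"
      | "pos a n < 0" by linarith
    then show ?case
    proof cases
      case 1
      then have "pos b (Suc (m n)) = pos a (Suc n)" using Suc b1 by (auto simp: pos_Suc max_def)
      with 1 Suc show ?thesis by (auto simp: m_Suc visits_Suc pos_Suc max_def)
    next
      case 2
      then have "pos b (Suc (m n)) = 1" using Suc b0 by (auto simp: pos_Suc max_def)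
      with 2 Suc show ?thesis by (auto simp: m_Suc visits_Suc)
    next
      case 3
      with Suc show ?thesis by (auto simp: m_Suc visits_Suc)
    next
      case 4
      then have "pos a (Suc n) \<le> 0" by (simp add: pos_Suc)
      with 4 Suc show ?thesis by (auto simp: m_Suc visits_Suc)
    qed
  qed
  have m_le: "m n \<le> n" for n by (induction n) (auto simp: m_0 m_Suc)
  have a_ev: "eventually (\<lambda>n. pos a n \<ge> Z) sequentially" for Z
    using assms by (auto simp: escapes_def filterlim_at_top)
  obtain N where N: "\<And>n. n \<ge> N \<Longrightarrow> pos a n \<ge> 1"
    using a_ev[of 1] by (auto simp: eventually_sequentially)
  have m_large: "m (N + i) \<ge> i" for i
    by (induction i) (auto simp: m_Suc N)
  \<comment> \<open>The clock \<open>m\<close> starts at 0, advances by at most one and is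
    unbounded, so it takes every value.\<close>
  have m_surj: "\<exists>n. m n = j" for j
  proof -
    have "\<exists>n. m n = i" if "i \<le> m n" for n i
      using that
    proof (induction n)
      case (Suc n)
      show ?case
      proof (cases "i = m (Suc n)")
        case False
        then have "i \<le> m n" using Suc.prems by (auto simp: m_Suc split: if_splits)
        then show ?thesis by (rule Suc.IH)
      qed blast
    qed (auto simp: m_0 intro!: exI[of _ 0])
    then show ?thesis using m_large by blast
  qed
  have b_ev: "eventually (\<lambda>j. pos b j \<ge> Z) sequentially" for Z
  proof -
    obtain L where L: "\<And>n. n \<ge> L \<Longrightarrow> pos a n \<ge> Z"
      using a_ev[of Z] by (auto simp: eventually_sequentially)
    \<comment> \<open>\<open>m n \<le> n\<close> turns a late time \<open>j\<close> of
      \<open>b\<close> into a time \<open>n \<ge> j\<close> of \<open>a\<close>.\<close>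
    have "pos b j \<ge> Z" if "j \<ge> L" for j
    proof -
      obtain n where "m n = j" using m_surj by blast
      then show ?thesis using L[of n] inv[of n] m_le[of n] that by auto
    qed
    then show ?thesis by (auto simp: eventually_sequentially)
  qed
  obtain L where L: "\<And>n. n \<ge> L \<Longrightarrow> pos b n \<ge> 1"
    using b_ev[of 1] by (auto simp: eventually_sequentially)
  have vis0: "visits b n 0 \<le> visits b L 0" for n
  proof (cases "n \<le> L")
    case False
    then have "L \<le> n" by simp
    then show ?thesis
    proof (induction n rule: dec_induct)
      case (step n)
      then show ?case using L[of "Suc n"] by (auto simp: visits_Suc)
    qed auto
  qed (auto intro: visits_mono)
  \<comment> \<open>From time \<open>L\<close> on, \<open>b\<close> stays at sites at least 1, so at
    0 it reads only arrows up to number \<open>visits b L 0\<close>. Forcing this finite block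
    suffices.\<close>
  define c where "c = (\<lambda>(x, n). if x = 0 \<and> n \<in> {1..visits b L 0} then True else a (x, n))"
  have "pos c (0 + n) = 0 + pos b n" for n
  proof (rule pos_after_first_hit)
    show "b (pos b n, visits b n (pos b n)) = c (0 + pos b n, visits b n (pos b n))" for n
      using vis0[of n] visits_pos[of b n] by (cases "pos b n = 0") (auto simp: b_def c_def)
  qed (use b_nonneg in auto)
  then have "pos c = pos b" by auto
  then have "positive_escape c"
    using b_nonneg b_ev by (simp add: positive_escape_def escapes_def filterlim_at_top)
  then show ?thesis unfolding c_def by blast
qed

subsection \<open>Infinite product measures\<close>

text \<open>Replacing coordinate \<open>i\<close> by an independent copy preserves the product law;
  Fubini's theorem then separates the new value from the old point.\<close>

lemma AE_PiM_resample:
  assumes M: "\<And>j. prob_space (M j)" and [measurable]: "Measurable.pred (PiM UNIV M) P"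
    and AE: "AE v in PiM UNIV M. P v"
  shows "AE v in PiM UNIV M. AE x in M i. P (v(i := x))"
proof -
  interpret Mi: prob_space "M i" by (rule M)
  interpret P: prob_space "PiM UNIV M" by (intro prob_space_PiM M)
  interpret pair: pair_prob_space "M i" "PiM UNIV M" ..
  have [measurable]: "(\<lambda>z. (snd z)(i := fst z)) \<in> measurable (M i \<Otimes>\<^sub>M PiM UNIV M) (PiM UNIV M)"
    using measurable_fun_upd[of UNIV UNIV i snd "M i \<Otimes>\<^sub>M PiM UNIV M" M fst] by simp
  have resample: "distr (M i \<Otimes>\<^sub>M PiM UNIV M) (PiM UNIV M) (\<lambda>z. (snd z)(i := fst z)) = PiM UNIV M"
    using distr_pair_PiM_eq_PiM[of UNIV M i] M by (simp add: case_prod_beta')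
  have "AE v in distr (M i \<Otimes>\<^sub>M PiM UNIV M) (PiM UNIV M) (\<lambda>z. (snd z)(i := fst z)). P v"
    unfolding resample by (rule AE)
  then have "AE z in M i \<Otimes>\<^sub>M PiM UNIV M. P ((snd z)(i := fst z))"
    by (rule AE_distrD[rotated]) measurable
  moreover have "{z \<in> space (M i \<Otimes>\<^sub>M PiM UNIV M). P ((snd z)(i := fst z))} \<in> sets (M i \<Otimes>\<^sub>M PiM UNIV M)"
    by measurable
  ultimately show ?thesis
    using pair.AE_pair_iff[where P = "\<lambda>x v. P (v(i := x))"] pair.AE_commute[where P = "\<lambda>x v. P (v(i := x))"]
    by blast
qed

text \<open>An event not depending on coordinate \<open>i\<close> is independent of that coordinate,
  again by resampling it.\<close>

lemma emeasure_PiM_fresh: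
  assumes M: "\<And>j. prob_space (M j)"
    and [measurable]: "Measurable.pred (PiM UNIV M) Q" "Measurable.pred (M i) R"
    and fresh: "\<And>v x. Q (v(i := x)) = Q v"
  shows "emeasure (PiM UNIV M) {v \<in> space (PiM UNIV M). Q v \<and> R (v i)} =
    emeasure (PiM UNIV M) {v \<in> space (PiM UNIV M). Q v} * emeasure (M i) {x \<in> space (M i). R x}"
proof -
  interpret Mi: prob_space "M i" by (rule M)
  interpret P: prob_space "PiM UNIV M" by (intro prob_space_PiM M)
  let ?g = "\<lambda>z. (snd z)(i := fst z)"
  have [measurable]: "?g \<in> measurable (M i \<Otimes>\<^sub>M PiM UNIV M) (PiM UNIV M)"
    using measurable_fun_upd[of UNIV UNIV i snd "M i \<Otimes>\<^sub>M PiM UNIV M" M fst] by simp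
  have resample: "distr (M i \<Otimes>\<^sub>M PiM UNIV M) (PiM UNIV M) ?g = PiM UNIV M"
    using distr_pair_PiM_eq_PiM[of UNIV M i] M by (simp add: case_prod_beta')
  have "emeasure (PiM UNIV M) {v \<in> space (PiM UNIV M). Q v \<and> R (v i)} =
      emeasure (distr (M i \<Otimes>\<^sub>M PiM UNIV M) (PiM UNIV M) ?g) {v \<in> space (PiM UNIV M). Q v \<and> R (v i)}"
    by (simp add: resample)
  also have "\<dots> = emeasure (M i \<Otimes>\<^sub>M PiM UNIV M)
      (?g -` {v \<in> space (PiM UNIV M). Q v \<and> R (v i)} \<inter> space (M i \<Otimes>\<^sub>M PiM UNIV M))"
    by (rule emeasure_distr) measurable
  \<comment> \<open>Since \<open>Q\<close> is blind to coordinate \<open>i\<close>, resampling turns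
    the event into a rectangle.\<close>
  also have "?g -` {v \<in> space (PiM UNIV M). Q v \<and> R (v i)} \<inter> space (M i \<Otimes>\<^sub>M PiM UNIV M) =
      {x \<in> space (M i). R x} \<times> {v \<in> space (PiM UNIV M). Q v}"
    by (auto simp: fresh space_pair_measure space_PiM PiE_iff)
  also have "emeasure (M i \<Otimes>\<^sub>M PiM UNIV M) \<dots> =
      emeasure (M i) {x \<in> space (M i). R x} * emeasure (PiM UNIV M) {v \<in> space (PiM UNIV M). Q v}"
    by (rule P.emeasure_pair_measure_Times) measurable
  finally show ?thesis by (simp add: mult.commute)
qed

text \<open>Kolmogorov's law: invariance under changing one coordinate gives invariance under
  changing finitely many, hence tail measurability once the index set is enumerated.\<close>

lemma PiM_zero_one_law:
  fixes M :: "'i::countable \<Rightarrow> 'a measure"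
  assumes M: "\<And>j. prob_space (M j)" and inf: "infinite (UNIV :: 'i set)"
    and T: "T \<in> sets (PiM UNIV M)"
    and upd: "\<And>v i x. v \<in> space (PiM UNIV M) \<Longrightarrow> x \<in> space (M i) \<Longrightarrow> v(i := x) \<in> T \<longleftrightarrow> v \<in> T"
  shows "measure (PiM UNIV M) T = 0 \<or> measure (PiM UNIV M) T = 1"
proof -
  let ?P = "PiM UNIV M"
  interpret P: prob_space ?P by (intro prob_space_PiM M)
  define e where "e = from_nat_into (UNIV :: 'i set)"
  have e: "bij e" unfolding e_def using bij_betw_from_nat_into[OF _ inf] by simp
  define A where "A n = {(\<lambda>v. v (e n)) -` B \<inter> space ?P | B. B \<in> sets (M (e n))}" for n
  obtain c where c: "c \<in> space ?P" using P.not_empty by blast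
  show ?thesis
  proof (rule P.kolmogorov_0_1_law[of A])
    show "sigma_algebra (space ?P) (A n)" for n
    proof -
      have "A n = sets (vimage_algebra (space ?P) (\<lambda>v. v (e n)) (M (e n)))"
        unfolding A_def by (subst sets_vimage_algebra2) (auto simp: space_PiM)
      then show ?thesis using sets.sigma_algebra_axioms[of "vimage_algebra (space ?P) (\<lambda>v. v (e n)) (M (e n))"]
        by simp
    qed
  next
    have "distr ?P (PiM UNIV (\<lambda>n. M (e n))) (\<lambda>v. \<lambda>n\<in>UNIV. v (e n)) = PiM UNIV (\<lambda>n. M (e n))"
      using M e by (intro distr_PiM_reindex) (auto simp: bij_def)
    moreover have "distr ?P (M (e n)) (\<lambda>v. v (e n)) = M (e n)" for n
      using M by (intro distr_PiM_component) auto
    ultimately have "P.indep_vars (\<lambda>n. M (e n)) (\<lambda>n v. v (e n)) UNIV"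
      by (subst P.indep_vars_iff_distr_eq_PiM) auto
    then show "P.indep_sets A UNIV"
      unfolding P.indep_vars_def2 A_def by simp
  next
    show "T \<in> P.tail_events A"
      unfolding P.tail_events_def
    proof
      fix n
      \<comment> \<open>\<open>g\<close> overwrites the first \<open>n\<close> coordinates by those
        of a fixed point \<open>c\<close>. It is measurable with respect to the later coordinates,
        and \<open>T\<close> is its own preimage under \<open>g\<close>.\<close>
      define g where "g v = (\<lambda>i. if i \<in> e ` {..<n} then c i else v i)" for v
      let ?S = "sigma (space ?P) (\<Union> (A ` {n..}))"
      have sub: "\<Union> (A ` {n..}) \<subseteq> Pow (space ?P)" by (auto simp: A_def)
      have coord: "(\<lambda>v. v i) \<in> measurable ?S (M i)" if "i \<notin> e ` {..<n}" for i
      proof -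
        obtain m where m: "i = e m" using e by (metis bij_pointE)
        with that have "m \<ge> n" by (metis imageI lessThan_iff not_less)
        then show ?thesis using m sub
          by (intro measurableI) (auto simp: space_PiM A_def intro!: sigma_sets.Basic)
      qed
      have "g \<in> measurable ?S ?P"
      proof (rule measurable_PiM_single')
        show "(\<lambda>v. g v i) \<in> measurable ?S (M i)" if "i \<in> UNIV" for i
          using c coord[of i] by (cases "i \<in> e ` {..<n}") (auto simp: g_def space_PiM PiE_iff)
        show "g \<in> space ?S \<rightarrow> (\<Pi>\<^sub>E i\<in>UNIV. space (M i))"
          using c sub by (auto simp: g_def space_PiM PiE_iff)
      qed
      then have "g -` T \<inter> space ?S \<in> sets ?S" using T by (rule measurable_sets)
      moreover have "g v \<in> T \<longleftrightarrow> v \<in> T" if v: "v \<in> space ?P" for v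
      proof -
        have "(\<lambda>i. if i \<in> F then c i else v i) \<in> T \<longleftrightarrow> v \<in> T" if "finite F" for F
          using that
        proof induction
          case (insert j F)
          have "(\<lambda>i. if i \<in> insert j F then c i else v i) = (\<lambda>i. if i \<in> F then c i else v i)(j := c j)"
            by auto
          moreover have "(\<lambda>i. if i \<in> F then c i else v i) \<in> space ?P"
            using c v by (auto simp: space_PiM PiE_iff)
          ultimately show ?case using insert c upd by (auto simp: space_PiM PiE_iff)
        qed simp
        then show ?thesis unfolding g_def by simp
      qed
      ultimately show "T \<in> sigma_sets (space ?P) (\<Union> (A ` {n..}))"
        using sets.sets_into_space[OF T] sub by (simp add: space_measure_of sets_measure_of Int_def) (smt (verit) Collect_cong mem_Collect_eq Collect_mem_eq subsetD)
    qed
  qed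
qed

text \<open>Continuity from above along the decreasing tail unions, each of which contains an event
  of probability at least \<open>c\<close>.\<close>

lemma (in prob_space) measure_limsup_ge:
  fixes B :: "nat \<Rightarrow> 'a set"
  assumes B: "\<And>j. B j \<in> events" and freq: "\<And>N. \<exists>j\<ge>N. prob (B j) \<ge> c"
  shows "prob {x \<in> space M. \<forall>N. \<exists>j\<ge>N. x \<in> B j} \<ge> c"
proof -
  have "(\<lambda>N. prob (\<Union>j\<in>{N..}. B j)) \<longlonglongrightarrow> prob (\<Inter>N. \<Union>j\<in>{N..}. B j)"
    using B by (intro finite_Lim_measure_decseq) (auto simp: decseq_def intro: order_trans)
  moreover have "prob (\<Union>j\<in>{N..}. B j) \<ge> c" for N
  proof -
    obtain j where j: "j \<ge> N" "prob (B j) \<ge> c" using freq by blast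
    have "prob (B j) \<le> prob (\<Union>j\<in>{N..}. B j)"
      using B j by (intro finite_measure_mono) auto
    with j show ?thesis by simp
  qed
  ultimately have "c \<le> prob (\<Inter>N. \<Union>j\<in>{N..}. B j)"
    by (intro LIMSEQ_le_const) auto
  also have "(\<Inter>N. \<Union>j\<in>{N..}. B j) = {x \<in> space M. \<forall>N. \<exists>j\<ge>N. x \<in> B j}"
    using sets.sets_into_space[OF B] by fastforce
  finally show ?thesis .
qed

subsection \<open>Random arrows\<close>

abbreviation arrow_space :: "(int \<times> nat \<Rightarrow> bool) measure" where
  "arrow_space \<equiv> PiM UNIV (\<lambda>_. count_space UNIV)"

definition uniform_field :: "('i \<Rightarrow> real) measure" where
  "uniform_field = PiM UNIV (\<lambda>_. uniform_measure lborel {0..1})"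

definition arrows :: "int \<Rightarrow> env \<times> (int \<times> nat \<Rightarrow> real) \<Rightarrow> int \<times> nat \<Rightarrow> bool" where
  "arrows s z = orient s (\<lambda>i. snd z i < fst z i)"

section \<open>Measurability, translations and reflections of the fields\<close>

lemma prob_space_uniform: "prob_space (uniform_measure lborel {0..1::real})"
  by (rule prob_space_uniform_measure) auto

lemma prob_space_uniform_field: "prob_space uniform_field"
  unfolding uniform_field_def by (intro prob_space_PiM prob_space_uniform)

lemma space_uniform_field [simp]: "space uniform_field = UNIV"
  by (simp add: uniform_field_def space_PiM)

lemma sets_uniform_field: "sets uniform_field = sets (PiM UNIV (\<lambda>_. borel))"
  unfolding uniform_field_def by (intro sets_PiM_cong) auto

lemma measurable_uniform_field_component [measurable]: "(\<lambda>v. v i) \<in> borel_measurable uniform_field"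
  unfolding measurable_cong_sets[OF sets_uniform_field refl] by measurable

lemma space_arrow_space [simp]: "space arrow_space = UNIV"
  by (simp add: space_PiM)

lemma measurable_cookie_component [measurable]: "(\<lambda>\<omega>. \<omega> i) \<in> borel_measurable cookie_space"
proof -
  have "(\<lambda>\<omega>. \<omega> i) \<in> measurable cookie_space (restrict_space borel {0..1})"
    unfolding cookie_space_def by measurable
  then show ?thesis by (simp add: measurable_restrict_space2_iff)
qed

lemma translate_alt: "translate j a = (\<lambda>i. a (fst i + j, snd i))"
  by (auto simp: translate_def)

lemma translate_translate: "translate j (translate k a) = translate (j + k) a"
  by (auto simp: translate_def add_ac)

lemma translate_0 [simp]: "translate 0 a = a"
  by (auto simp: translate_def)

lemma measurable_translate: "translate j \<in> measurable (PiM UNIV (\<lambda>_. N)) (PiM UNIV (\<lambda>_. N))"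
  unfolding translate_alt by (rule measurable_PiM_single') (auto simp: space_PiM PiE_iff)

lemmas [measurable] = measurable_translate[of j "count_space UNIV"] for j

lemma measurable_translate_uniform [measurable]: "translate j \<in> measurable uniform_field uniform_field"
  unfolding uniform_field_def by (rule measurable_translate)

lemma measurable_translate_cookie [measurable]: "translate j \<in> measurable cookie_space cookie_space"
  unfolding cookie_space_def by (rule measurable_translate)

lemma distr_translate_uniform: "distr uniform_field uniform_field (translate j) = uniform_field"
proof -
  have "inj (\<lambda>i::int \<times> nat. (fst i + j, snd i))" by (auto simp: inj_def prod_eq_iff)
  then show ?thesis
    using distr_PiM_reindex[of UNIV "\<lambda>_. uniform_measure lborel {0..1::real}" "\<lambda>i::int \<times> nat. (fst i + j, snd i)" UNIV]
    by (simp add: translate_alt[abs_def] uniform_field_def prob_space_uniform restrict_UNIV)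
qed

lemma measurable_arrow_traj [measurable]: "(\<lambda>a. arrow_traj a n) \<in> measurable arrow_space (count_space UNIV)"
proof (induction n)
  case (Suc n)
  note Suc [measurable]
  show ?case unfolding arrow_traj.simps Let_def
    by (rule measurable_compose_countable[where g = "\<lambda>a. arrow_traj a n"]) measurable
qed simp

lemma measurable_pos [measurable]: "(\<lambda>a. pos a n) \<in> measurable arrow_space (count_space UNIV)"
  unfolding pos_def by measurable

lemma pred_escapes [measurable]: "Measurable.pred arrow_space escapes"
  unfolding escapes_def filterlim_at_top eventually_sequentially by measurable

lemma pred_positive_escape [measurable]: "Measurable.pred arrow_space positive_escape"
  unfolding positive_escape_def by measurable

lemma measurable_orient [measurable]: "orient s \<in> measurable arrow_space arrow_space"
proof -
  have "orient s = (\<lambda>a i. a (s * fst i, snd i) = (s = 1))" by (simp add: orient_def fun_eq_iff)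
  then show ?thesis
    by (auto intro!: measurable_PiM_single' simp: space_PiM)
qed

lemma measurable_arrow_upd: "(\<lambda>a. a(i := b)) \<in> measurable arrow_space arrow_space"
  using measurable_fun_upd[of UNIV UNIV i "\<lambda>a. a" arrow_space "\<lambda>_. count_space UNIV" "\<lambda>_. b"] by simp

text \<open>Reflection reverses the direction of translation, hence the factor
  \<open>s\<close>.\<close>

lemma translate_orient: "s \<in> {1, -1} \<Longrightarrow> translate j (orient s a) = orient s (translate (s * j) a)"
  by (auto simp: translate_def orient_def algebra_simps)

lemma translate_arrows:
  "s \<in> {1, -1} \<Longrightarrow> translate j (arrows s (\<omega>, v)) = arrows s (translate (s * j) \<omega>, translate (s * j) v)"
  unfolding arrows_def translate_orient by (simp add: translate_alt)

text \<open>Both outcomes of the comparison have positive probability, so an almost sure property of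
  the outcome holds for each of them.\<close>

lemma AE_uniform_threshold:
  fixes p :: real
  assumes p: "0 < p" "p < 1" and AE: "AE y in uniform_measure lborel {0..1}. Q (y < p)"
  shows "Q b"
proof (rule ccontr)
  assume "\<not> Q b"
  \<comment> \<open>An interval of positive length on which \<open>y < p\<close> has the truth value
    \<open>b\<close>.\<close>
  define I where "I = (if b then {0<..<p} else {p<..<1})"
  have [measurable]: "Measurable.pred lborel (\<lambda>y. Q (y < p))" by measurable
  have "AE y in lborel. y \<in> {0..1} \<longrightarrow> Q (y < p)"
    using AE by (simp add: AE_uniform_measure)
  then have "AE y in lborel. y \<notin> I"
    by eventually_elim (use p \<open>\<not> Q b\<close> in \<open>auto simp: I_def split: if_splits\<close>)
  then have "emeasure lborel I = 0"
    by (subst (asm) AE_iff_measurable[of I]) (auto simp: I_def)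
  then show False using p by (auto simp: I_def split: if_splits)
qed

subsection \<open>Stationary ergodic elliptic environments\<close>

locale cookie_environment = prob_space \<mu> for \<mu> :: "env measure" +
  assumes sets_eq: "sets \<mu> = sets cookie_space"
    and stationary: "stationary \<mu>" and ergodic: "ergodic \<mu>" and elliptic: "elliptic \<mu>"
begin

sublocale U: prob_space "uniform_field :: (int \<times> nat \<Rightarrow> real) measure"
  by (rule prob_space_uniform_field)

sublocale joint: pair_prob_space \<mu> "uniform_field :: (int \<times> nat \<Rightarrow> real) measure" ..

abbreviation joint :: "(env \<times> (int \<times> nat \<Rightarrow> real)) measure" where
  "joint \<equiv> \<mu> \<Otimes>\<^sub>M uniform_field"

section \<open>Translation invariance of the joint law\<close>

lemma measurable_env_eq: "measurable \<mu> N = measurable cookie_space N"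
  by (rule measurable_cong_sets) (simp_all add: sets_eq)

lemma measurable_env_component [measurable]: "(\<lambda>\<omega>. \<omega> i) \<in> borel_measurable \<mu>"
  unfolding measurable_env_eq by measurable

lemma measurable_translate_env [measurable]: "translate j \<in> measurable \<mu> \<mu>"
  using measurable_translate_cookie measurable_cong_sets[OF sets_eq sets_eq] by auto

lemma measurable_arrows [measurable]: "arrows s \<in> measurable joint arrow_space"
proof -
  have "(\<lambda>z i. snd z i < fst z i) \<in> measurable joint arrow_space"
    by (rule measurable_PiM_single') auto
  then show ?thesis unfolding arrows_def by measurable
qed

lemma distr_translate_env: "distr \<mu> \<mu> (translate j) = \<mu>"
proof -
  have 1: "distr \<mu> \<mu> (translate 1) = \<mu>"
    using stationary distr_cong[OF refl sets_eq, of \<mu> shift shift]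
    unfolding stationary_def shift_def[abs_def] translate_def[abs_def] by simp
  have comp: "distr (distr \<mu> \<mu> (translate j)) \<mu> (translate k) = distr \<mu> \<mu> (translate (k + j))" for j k
    by (subst distr_distr) (auto simp: comp_def translate_translate)
  have "distr \<mu> \<mu> (\<lambda>\<omega>. \<omega>) = \<mu>" by simp
  then have 0: "distr \<mu> \<mu> (translate 0) = \<mu>" by (simp add: translate_def[abs_def])
  \<comment> \<open>Write \<open>\<mu>\<close> as its own image under \<open>translate 1\<close>;
    applying \<open>translate (-1)\<close> undoes that translation.\<close>
  have m1: "distr \<mu> \<mu> (translate (-1)) = \<mu>"
    using comp[of 1 "-1"] 1 0 by simp
  show ?thesis
  proof (induction j rule: int_induct[where k = 0])
    case (step1 i)
    then show ?case using comp[of i 1] 1 by (simp add: add.commute)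
  next
    case (step2 i)
    then show ?case using comp[of i "-1"] m1 by simp
  qed (rule 0)
qed

text \<open>Cookies and uniform variables are translated together; both laws are invariant, and so
  is their product.\<close>

lemma AE_translate:
  assumes s: "s \<in> {1, -1}" and [measurable]: "Measurable.pred arrow_space Q"
    and AE: "AE z in joint. Q (arrows s z)"
  shows "AE z in joint. Q (translate j (arrows s z))"
proof -
  let ?T = "\<lambda>(\<omega>, v). (translate (s * j) \<omega>, translate (s * j) v)"
  have T: "distr joint joint ?T = joint"
    using pair_measure_distr[of "translate (s * j)" \<mu> \<mu> "translate (s * j)" uniform_field uniform_field]
    by (simp add: distr_translate_env distr_translate_uniform U.sigma_finite_measure_axioms)
  have "AE z in distr joint joint ?T. Q (arrows s z)" unfolding T by (rule AE)
  then have "AE z in joint. Q (arrows s (?T z))"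
    by (rule AE_distrD[rotated]) measurable
  then show ?thesis
    by eventually_elim (use translate_arrows[OF s] in \<open>auto split: prod.splits\<close>)
qed

text \<open>The set \<open>S\<close> of environments that return to \<open>G\<close> infinitely
  often is shift invariant. By stationarity it has at least the measure of \<open>G\<close>, so
  ergodicity gives it measure 1.\<close>

lemma ergodic_recurrence:
  assumes s: "s \<in> {1, -1}" and G: "G \<in> sets \<mu>" "measure \<mu> G > 0"
  shows "AE \<omega> in \<mu>. \<forall>N. \<exists>j\<ge>N. translate (s * int j) \<omega> \<in> G"
proof -
  define S where "S = {\<omega> \<in> space \<mu>. \<forall>N. \<exists>j\<ge>N. \<omega> \<in> translate (s * int j) -` G \<inter> space \<mu>}"
  have ev [measurable]: "translate (s * int j) -` G \<inter> space \<mu> \<in> sets \<mu>" for j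
    using G by (intro measurable_sets[OF measurable_translate_env])
  have "measure \<mu> (translate (s * int j) -` G \<inter> space \<mu>) = measure \<mu> G" for j
    using measure_distr[OF measurable_translate_env G(1), of "s * int j"] by (simp add: distr_translate_env)
  then have "measure \<mu> S \<ge> measure \<mu> G"
    unfolding S_def using ev by (intro measure_limsup_ge) auto
  moreover have "S \<in> sets \<mu>" unfolding S_def by measurable
  moreover have "shift -` S \<inter> space \<mu> = S"
  proof -
    have shift: "shift = translate 1" by (simp add: shift_def[abs_def] translate_def[abs_def])
    have sp: "translate j \<omega> \<in> space \<mu>" if "\<omega> \<in> space \<mu>" for \<omega> j
      using measurable_space[OF measurable_translate_env that] .
    have shiftN: "(\<forall>N. \<exists>j\<ge>N. P (j + 1)) \<longleftrightarrow> (\<forall>N. \<exists>j\<ge>N. P j)" for P :: "nat \<Rightarrow> bool"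
      by (metis Suc_eq_plus1 Suc_le_D Suc_le_mono le_SucI)
    have inf: "(\<forall>N. \<exists>j\<ge>N. translate (s * int j) (translate 1 \<omega>) \<in> G) \<longleftrightarrow>
      (\<forall>N. \<exists>j\<ge>N. translate (s * int j) \<omega> \<in> G)" for \<omega>
    proof (cases "s = 1")
      case True
      then show ?thesis
        using shiftN[of "\<lambda>j. translate (int j) \<omega> \<in> G"] by (simp add: translate_translate add.commute)
    next
      case False
      then have "s = -1" using s by simp
      \<comment> \<open>Here the shift moves the sequence of translates by one step in the opposite
        direction.\<close>
      then show ?thesis
        using shiftN[of "\<lambda>j. translate (1 - int j) \<omega> \<in> G"] by (simp add: translate_translate)
    qed
    show ?thesis
    proof (intro set_eqI)
      fix \<omega>
      show "\<omega> \<in> shift -` S \<inter> space \<mu> \<longleftrightarrow> \<omega> \<in> S"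
        using inf[of \<omega>] sp by (simp add: S_def shift) blast
    qed
  qed
  ultimately have "measure \<mu> S = 1"
    using ergodic G(2) unfolding ergodic_def by force
  then have "AE \<omega> in \<mu>. \<omega> \<in> S" using \<open>S \<in> sets \<mu>\<close> by (subst prob_eq_1[symmetric]) auto
  then show ?thesis by eventually_elim (auto simp: S_def)
qed

text \<open>Ergodicity handles the environment, and the zero-one law handles the uniform variables
  in a fixed environment. By \<open>half\<close>, far translates of \<open>E\<close> do not see any
  given uniform variable.\<close>

lemma infinitely_often:
  assumes s: "s \<in> {1, -1}" and [measurable]: "Measurable.pred arrow_space E"
    and half: "\<And>a b. (\<And>x n. x \<ge> 0 \<Longrightarrow> a (x, n) = b (x, n)) \<Longrightarrow> E a \<Longrightarrow> E b"
    and pos: "\<not> (AE z in joint. \<not> E (arrows s z))"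
  shows "AE z in joint. \<forall>N. \<exists>j\<ge>N. E (translate (int j) (arrows s z))"
proof -
  define f where "f \<omega> = U.prob {v. E (arrows s (\<omega>, v))}" for \<omega>
  have [measurable]: "{v. E (arrows s (\<omega>, v))} \<in> sets uniform_field" if "\<omega> \<in> space \<mu>" for \<omega>
  proof -
    have "{v \<in> space uniform_field. E (arrows s (\<omega>, v))} \<in> sets uniform_field"
      using that by measurable
    then show ?thesis by simp
  qed
  have [measurable]: "{z \<in> space joint. E (arrows s z)} \<in> sets joint" by measurable
  have "(\<lambda>\<omega>. emeasure uniform_field (Pair \<omega> -` {z \<in> space joint. E (arrows s z)})) \<in> borel_measurable \<mu>"
    by (intro U.measurable_emeasure_Pair) measurable
  then have "(\<lambda>\<omega>. measure uniform_field (Pair \<omega> -` {z \<in> space joint. E (arrows s z)})) \<in> borel_measurable \<mu>"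
    unfolding measure_def by measurable
  then have f_meas [measurable]: "f \<in> borel_measurable \<mu>"
    by (rule measurable_cong[THEN iffD1, rotated]) (auto simp: f_def space_pair_measure vimage_def)
  have "\<not> (AE \<omega> in \<mu>. f \<omega> = 0)"
  proof
    assume "AE \<omega> in \<mu>. f \<omega> = 0"
    then have "AE \<omega> in \<mu>. AE v in uniform_field. \<not> E (arrows s (\<omega>, v))"
    proof (rule AE_mp[OF _ AE_I2], intro impI)
      fix \<omega> assume "\<omega> \<in> space \<mu>" "f \<omega> = 0"
      then show "AE v in uniform_field. \<not> E (arrows s (\<omega>, v))"
        by (subst AE_iff_measurable[OF _ refl]) (auto simp: f_def U.emeasure_eq_measure)
    qed
    then have "AE z in joint. \<not> E (arrows s z)"
      by (intro joint.AE_pair_measure) auto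
    with pos show False by blast
  qed
  \<comment> \<open>A single lower bound on the quenched probability over a set of environments is
    needed, so that it serves for infinitely many translates at once.\<close>
  then obtain k where k: "\<not> (AE \<omega> in \<mu>. f \<omega> \<le> 1 / Suc k)"
  proof -
    have "AE \<omega> in \<mu>. f \<omega> = 0" if "\<And>k. AE \<omega> in \<mu>. f \<omega> \<le> 1 / Suc k"
    proof -
      have "AE \<omega> in \<mu>. \<forall>k. f \<omega> \<le> 1 / Suc k" using that by (simp add: AE_all_countable)
      then show ?thesis
      proof eventually_elim
        case (elim \<omega>)
        have "f \<omega> \<le> 0"
          using LIMSEQ_le_const[OF LIMSEQ_Suc[OF lim_inverse_n']] elim by (auto simp: inverse_eq_divide)
        then show ?case by (simp add: f_def measure_le_0_iff)
      qed
    qed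
    then show thesis using \<open>\<not> (AE \<omega> in \<mu>. f \<omega> = 0)\<close> that by blast
  qed
  define c where "c = 1 / real (Suc k)"
  have c: "c > 0" by (simp add: c_def)
  define G where "G = {\<omega> \<in> space \<mu>. f \<omega> > c}"
  have G [measurable]: "G \<in> sets \<mu>" unfolding G_def by measurable
  have "measure \<mu> G > 0"
  proof (rule ccontr)
    assume "\<not> ?thesis"
    then have "measure \<mu> G = 0" using measure_nonneg[of \<mu> G] by linarith
    then have "AE \<omega> in \<mu>. \<omega> \<notin> G" using G by (simp add: AE_iff_measurable[OF G] emeasure_eq_measure G_def)
    then have "AE \<omega> in \<mu>. f \<omega> \<le> 1 / Suc k"
      using AE_space by eventually_elim (auto simp: G_def c_def)
    with k show False by blast
  qed
  from ergodic_recurrence[OF s G this]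
  have "AE \<omega> in \<mu>. AE v in uniform_field. \<forall>N. \<exists>j\<ge>N. E (translate (int j) (arrows s (\<omega>, v)))"
  proof (rule AE_mp[OF _ AE_I2], intro impI)
    fix \<omega> assume \<omega>: "\<omega> \<in> space \<mu>" and rec: "\<forall>N. \<exists>j\<ge>N. translate (s * int j) \<omega> \<in> G"
    let ?D = "\<lambda>j. {v. E (translate (int j) (arrows s (\<omega>, v)))}"
    have [measurable]: "arrows s \<in> measurable joint arrow_space" by measurable
    have D [measurable]: "?D j \<in> sets uniform_field" for j
    proof -
      have "{v \<in> space uniform_field. E (translate (int j) (arrows s (\<omega>, v)))} \<in> sets uniform_field"
        using \<omega> by measurable
      then show ?thesis by simp
    qed
    \<comment> \<open>Translating the uniform field along with the environment does not change
      probabilities.\<close>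
    have "U.prob (?D j) = f (translate (s * int j) \<omega>)" for j
    proof -
      let ?\<omega> = "translate (s * int j) \<omega>"
      have "?\<omega> \<in> space \<mu>" using measurable_space[OF measurable_translate_env \<omega>] .
      then have "U.prob (translate (s * int j) -` {v. E (arrows s (?\<omega>, v))} \<inter> space uniform_field) =
          measure (distr uniform_field uniform_field (translate (s * int j))) {v. E (arrows s (?\<omega>, v))}"
        by (intro measure_distr[symmetric]) measurable
      also have "translate (s * int j) -` {v. E (arrows s (?\<omega>, v))} \<inter> space uniform_field = ?D j"
        using s by (auto simp: translate_arrows)
      finally show ?thesis by (simp add: distr_translate_uniform f_def)
    qed
    then have "\<exists>j\<ge>N. c \<le> U.prob (?D j)" for N
      using rec[rule_format, of N] by (auto simp: G_def)
    then have "U.prob {v \<in> space uniform_field. \<forall>N. \<exists>j\<ge>N. v \<in> ?D j} \<ge> c"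
      by (intro U.measure_limsup_ge) auto
    moreover define T where "T = {v. \<forall>N. \<exists>j\<ge>N. v \<in> ?D j}"
    ultimately have "U.prob T > 0" using c by (simp add: T_def)
    moreover have T: "T \<in> sets uniform_field"
    proof -
      have "{v \<in> space uniform_field. \<forall>N. \<exists>j\<ge>N. v \<in> ?D j} \<in> sets uniform_field" by measurable
      then show ?thesis by (simp add: T_def)
    qed
    moreover have "U.prob T = 0 \<or> U.prob T = 1"
      unfolding uniform_field_def
    proof (rule PiM_zero_one_law)
      show "infinite (UNIV :: (int \<times> nat) set)" by (simp add: finite_prod)
      show "T \<in> sets (PiM UNIV (\<lambda>_. uniform_measure lborel {0..1}))"
        using T by (simp add: uniform_field_def)
      fix v :: "int \<times> nat \<Rightarrow> real" and i y
      let ?A = "\<lambda>j v. translate (int j) (arrows s (\<omega>, v))"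
      \<comment> \<open>The variable at \<open>i\<close> governs the arrow at site
        \<open>s * fst i\<close>, which lies to the left of \<open>j\<close> and so gets a negative
        coordinate after translation.\<close>
      have agree: "?A j (v(i := y)) (x, n) = ?A j v (x, n)" if "j \<ge> nat \<bar>fst i\<bar> + 1" "x \<ge> 0" for j x n
        using that s by (cases i) (auto simp: translate_def arrows_def orient_def)
      have eqv: "E (?A j (v(i := y))) \<longleftrightarrow> E (?A j v)" if "j \<ge> nat \<bar>fst i\<bar> + 1" for j
        using half agree[OF that] by metis
      have tail: "(\<forall>N. \<exists>j\<ge>N. P j) \<longleftrightarrow> (\<forall>N. \<exists>j\<ge>N. R j)" if "\<And>j. j \<ge> K \<Longrightarrow> P j \<longleftrightarrow> R j"
        for P R :: "nat \<Rightarrow> bool" and K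
        using that by (metis max.bounded_iff)
      show "v(i := y) \<in> T \<longleftrightarrow> v \<in> T"
        unfolding T_def mem_Collect_eq by (rule tail[OF eqv])
    qed (rule prob_space_uniform)
    ultimately have "U.prob T = 1" by linarith
    then have "AE v in uniform_field. v \<in> T" using T by (subst U.prob_eq_1[symmetric]) auto
    then show "AE v in uniform_field. \<forall>N. \<exists>j\<ge>N. E (translate (int j) (arrows s (\<omega>, v)))"
      by eventually_elim (simp add: T_def)
  qed
  then show ?thesis by (intro joint.AE_pair_measure) auto
qed

section \<open>Ellipticity and the change of finitely many arrows\<close>

lemma AE_elliptic: "AE \<omega> in \<mu>. \<forall>x n. n \<ge> 1 \<longrightarrow> \<omega> (x, n) \<in> {0<..<1}"
proof -
  have "AE \<omega> in \<mu>. \<omega> \<in> {\<omega> \<in> space \<mu>. \<forall>x n. n \<ge> 1 \<longrightarrow> \<omega> (x, n) \<in> {0<..<1}}"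
    using elliptic unfolding elliptic_def by (subst prob_eq_1[symmetric]) measurable
  then show ?thesis by eventually_elim simp
qed

text \<open>Given all other randomness, ellipticity leaves both directions of an arrow with positive
  probability, so an almost sure property survives forcing that arrow.\<close>

lemma AE_arrow_upd:
  assumes s: "s \<in> {1, -1}" and [measurable]: "Measurable.pred arrow_space E"
    and AE: "AE z in joint. E (arrows s z)" and n: "n \<ge> 1"
  shows "AE z in joint. E ((arrows s z)((x, n) := b))"
proof -
  note measurable_arrow_upd [measurable]
  let ?i = "(s * x, n)"
  have "AE \<omega> in \<mu>. AE v in uniform_field. E (arrows s (\<omega>, v))"
    using AE by (intro joint.AE_pair) auto
  with AE_elliptic AE_space[of \<mu>]
  have "AE \<omega> in \<mu>. AE v in uniform_field. E ((arrows s (\<omega>, v))((x, n) := b))"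
  proof eventually_elim
    case (elim \<omega>)
    have "Measurable.pred uniform_field (\<lambda>v. E (arrows s (\<omega>, v)))"
      using elim by measurable
    then have "AE v in uniform_field. AE y in uniform_measure lborel {0..1}. E (arrows s (\<omega>, v(?i := y)))"
      using elim(3) unfolding uniform_field_def by (intro AE_PiM_resample prob_space_uniform)
    then show ?case
    proof eventually_elim
      case (elim v)
      have p: "0 < \<omega> ?i" "\<omega> ?i < 1" using \<open>\<forall>x n. n \<ge> 1 \<longrightarrow> \<omega> (x, n) \<in> {0<..<1}\<close> n by auto
      have eq: "arrows s (\<omega>, v(?i := y)) = (arrows s (\<omega>, v))((x, n) := ((y < \<omega> ?i) = (s = 1)))" for y
        using s by (auto simp: arrows_def orient_def fun_eq_iff)
      \<comment> \<open>For \<open>s = -1\<close> an arrow is the negation of its comparison, so the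
        comparison must come out as \<open>b = (s = 1)\<close>.\<close>
      have "E ((arrows s (\<omega>, v))((x, n) := ((b = (s = 1)) = (s = 1))))"
        using AE_uniform_threshold[OF p, of "\<lambda>c. E ((arrows s (\<omega>, v))((x, n) := (c = (s = 1))))" "b = (s = 1)"]
          elim unfolding eq by blast
      then show ?case by (cases b; cases "s = 1") auto
    qed
  qed
  then show ?thesis by (intro joint.AE_pair_measure) auto
qed

lemma AE_arrow_upd_block:
  assumes s: "s \<in> {1, -1}" and E: "Measurable.pred arrow_space E"
    and AE: "AE z in joint. E (arrows s z)"
  shows "AE z in joint. E (\<lambda>(x, n). if x = 0 \<and> n \<in> {1..k} then b else arrows s z (x, n))"
  using E AE
proof (induction k arbitrary: E)
  case (Suc k)
  note Suc.prems(1) [measurable] measurable_arrow_upd [measurable]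
  have *: "AE z in joint. E ((arrows s z)((0, Suc k) := b))"
    by (rule AE_arrow_upd[OF s Suc.prems]) simp
  have "AE z in joint. (\<lambda>a. E (a((0, Suc k) := b)))
      (\<lambda>(x, n). if x = 0 \<and> n \<in> {1..k} then b else arrows s z (x, n))"
    by (rule Suc.IH) (use * in measurable)
  moreover have "(\<lambda>(x, n). if x = 0 \<and> n \<in> {1..k} then b else a (x, n))((0, Suc k) := b) =
      (\<lambda>(x, n). if x = 0 \<and> n \<in> {1..Suc k} then b else a (x, n))" for a :: "int \<times> nat \<Rightarrow> bool"
    by (auto simp: fun_eq_iff)
  ultimately show ?case by simp
qed (simp add: case_prod_beta')

lemma escape_dichotomy:
  assumes s: "s \<in> {1, -1}" and pos: "\<not> (AE z in joint. \<not> escapes (arrows s z))"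
  shows "AE z in joint. escapes (arrows s z) \<or> escapes (orient (-1) (arrows s z))"
proof -
  define blocked where "blocked a \<longleftrightarrow> (\<forall>n\<ge>1. \<not> a (0, n))" for a :: "int \<times> nat \<Rightarrow> bool"
  have [measurable]: "Measurable.pred arrow_space blocked"
    unfolding blocked_def by measurable
  \<comment> \<open>Otherwise there would almost surely be a barrier at some site
    \<open>j \<ge> 0\<close>, which bounds the walk.\<close>
  have "AE z in joint. \<not> blocked (arrows s z)"
  proof (rule ccontr)
    assume "\<not> ?thesis"
    then have "AE z in joint. \<forall>N. \<exists>j\<ge>N. blocked (translate (int j) (arrows s z))"
      by (intro infinitely_often[OF s]) (auto simp: blocked_def)
    then have "AE z in joint. \<not> escapes (arrows s z)"
    proof eventually_elim
      case (elim z)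
      then obtain j where "blocked (translate (int j) (arrows s z))" by blast
      then have "pos (arrows s z) n \<le> int j" for n
        by (intro pos_le_barrier) (auto simp: blocked_def translate_def)
      then show ?case by (rule not_escapes_bounded)
    qed
    with pos show False by blast
  qed
  \<comment> \<open>Even with its first \<open>k\<close> arrows forced down the site is not blocked,
    so some later arrow points up.\<close>
  then have "AE z in joint. \<not> blocked (\<lambda>(x, n). if x = 0 \<and> n \<in> {1..k} then False else arrows s z (x, n))" for k
    by (intro AE_arrow_upd_block[OF s]) measurable
  then have "AE z in joint. \<forall>k. \<not> blocked (\<lambda>(x, n). if x = 0 \<and> n \<in> {1..k} then False else arrows s z (x, n))"
    by (simp add: AE_all_countable)
  then have "AE z in joint. \<forall>k. \<exists>n>k. arrows s z (0, n)"
  proof eventually_elim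
    case (elim z)
    show ?case
    proof
      fix k
      show "\<exists>n>k. arrows s z (0, n)"
        using elim[rule_format, of k] unfolding blocked_def by (auto simp: not_le split: if_splits)
    qed
  qed
  then have "AE z in joint. \<forall>k. \<exists>n>k. translate j (arrows s z) (0, n)" for j
    by (intro AE_translate[OF s]) measurable
  then have arrows_up: "AE z in joint. \<forall>j k. \<exists>n>k. translate j (arrows s z) (0, n)"
    by (simp add: AE_all_countable)
  \<comment> \<open>By \<open>escapes_imp_positive_escape\<close>, escape becomes positive escape
    once a finite block at 0 is forced up. If positive escape were null, so would be escape.\<close>
  have "\<not> (AE z in joint. \<not> positive_escape (arrows s z))"
  proof
    assume "AE z in joint. \<not> positive_escape (arrows s z)"
    then have "AE z in joint. \<not> positive_escape
        (\<lambda>(x, n). if x = 0 \<and> n \<in> {1..k} then True else arrows s z (x, n))" for k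
      by (intro AE_arrow_upd_block[OF s]) measurable
    then have "AE z in joint. \<forall>k. \<not> positive_escape
        (\<lambda>(x, n). if x = 0 \<and> n \<in> {1..k} then True else arrows s z (x, n))"
      by (simp add: AE_all_countable)
    then have "AE z in joint. \<not> escapes (arrows s z)"
      by eventually_elim (use escapes_imp_positive_escape in blast)
    with pos show False by blast
  qed
  then have "AE z in joint. \<forall>N. \<exists>j\<ge>N. positive_escape (translate (int j) (arrows s z))"
    by (intro infinitely_often[OF s]) (auto intro: positive_escape_cong)
  with arrows_up show ?thesis
  proof eventually_elim
    case (elim z)
    let ?a = "arrows s z"
    \<comment> \<open>A walk bounded above tends to minus infinity; an unbounded one hits a site
      from which it escapes.\<close>
    show ?case
    proof (cases "\<exists>K. \<forall>n. pos ?a n \<le> K")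
      case True
      have "\<exists>n>k. ?a (y, n)" for y k
        using elim(1)[rule_format, of k y] by (simp add: translate_def)
      with True show ?thesis using bounded_imp_escapes_minus[of ?a] by blast
    next
      case False
      obtain j where j: "positive_escape (translate (int j) ?a)" using elim(2) by blast
      obtain n where "pos ?a n > int j" using False by (metis not_le)
      then show ?thesis using escapes_from_hit[OF _ _ j, of n] by simp
    qed
  qed
qed

end

subsection \<open>The law of the excited random walk\<close>

lemma traj_cong: "(\<And>k. k < n \<Longrightarrow> U k = V k) \<Longrightarrow> traj \<omega> x U n = traj \<omega> x V n"
  by (induction n) (auto simp: Let_def)

lemma length_traj [simp]: "length (traj \<omega> x U n) = Suc n"
  by (induction n) (auto simp: Let_def)

lemma length_arrow_traj [simp]: "length (arrow_traj a n) = Suc n"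
  by (induction n) (auto simp: Let_def)

lemma traj_neq_Nil [simp]: "traj \<omega> x U n \<noteq> []" and arrow_traj_neq_Nil [simp]: "arrow_traj a n \<noteq> []"
  using length_traj[of \<omega> x U n] length_arrow_traj[of a n] by (metis list.size(3) nat.distinct(1))+

lemma walk_eq_nth: "j \<le> n \<Longrightarrow> walk \<omega> x U j = traj \<omega> x U n ! j"
proof (induction n rule: dec_induct)
  case base
  then show ?case by (simp add: walk_def last_conv_nth)
next
  case (step n)
  then show ?case by (simp add: Let_def nth_append)
qed

lemma pos_eq_nth: "j \<le> n \<Longrightarrow> pos a j = arrow_traj a n ! j"
proof (induction n rule: dec_induct)
  case base
  then show ?case by (simp add: pos_def last_conv_nth)
next
  case (step n)
  then show ?case by (simp add: Let_def nth_append)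
qed

text \<open>The arrow read in the step after time \<open>n\<close> has not been read before, hence it
  is independent of the trajectory up to time \<open>n\<close>.\<close>

lemma arrow_traj_unread:
  assumes "\<And>i. i \<noteq> (pos a n, visits a n (pos a n)) \<Longrightarrow> a i = b i"
  shows "arrow_traj b n = arrow_traj a n"
proof -
  have "arrow_traj b m = arrow_traj a m" if "m \<le> n" for m
    using that
  proof (induction m)
    case (Suc m)
    \<comment> \<open>Each arrival at a site raises its visit count, so no pair of site and visit
      number occurs twice.\<close>
    have "(pos a m, visits a m (pos a m)) \<noteq> (pos a n, visits a n (pos a n))"
    proof
      assume eq: "(pos a m, visits a m (pos a m)) = (pos a n, visits a n (pos a n))"
      obtain k where k: "n = Suc k" using Suc by (cases n) auto
      then have "visits a m (pos a n) \<le> visits a k (pos a n)" using Suc by (intro visits_mono) auto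
      moreover have "visits a n (pos a n) = Suc (visits a k (pos a n))"
        using visits_Suc[of a k "pos a n"] k by simp
      moreover have "visits a m (pos a n) = visits a n (pos a n)" using eq by (metis prod.inject)
      ultimately show False by linarith
    qed
    then show ?case using Suc assms by (simp add: Let_def pos_def visits_def)
  qed simp
  then show ?thesis by blast
qed

section \<open>The quenched law as the law of the arrow walk\<close>

lemma unif_seq_eq: "unif_seq = uniform_field"
  by (simp add: unif_seq_def uniform_field_def)

lemma measurable_traj: "(\<lambda>U. traj \<omega> x U n) \<in> measurable uniform_field (count_space UNIV)"
proof (induction n)
  case (Suc n)
  note Suc [measurable]
  show ?case unfolding traj.simps Let_def
    by (rule measurable_compose_countable[where g = "\<lambda>U. traj \<omega> x U n"]) measurable
qed simp

lemma measurable_walk: "walk \<omega> x \<in> measurable uniform_field path_space"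
  unfolding path_space_def walk_def[abs_def]
  by (intro measurable_PiM_single') (auto intro: measurable_compose[OF measurable_traj])

lemma prob_space_quenched: "prob_space (quenched \<omega> x)"
  unfolding quenched_def unif_seq_eq
  by (rule prob_space.prob_space_distr[OF prob_space_uniform_field measurable_walk])

lemma measurable_threshold_arrows: "(\<lambda>v i. v i < \<omega> i) \<in> measurable uniform_field arrow_space"
  for \<omega> :: env
  by (rule measurable_PiM_single') auto

lemma emeasure_uniform_field_fresh:
  assumes [measurable]: "Measurable.pred uniform_field Q" "Measurable.pred borel R"
    and fresh: "\<And>v x. Q (v(i := x)) = Q v"
  shows "emeasure uniform_field {v. Q v \<and> R (v i)} =
    emeasure uniform_field {v. Q v} * emeasure (uniform_measure lborel {0..1}) {u. R u}"
proof -
  have "Measurable.pred (uniform_measure lborel {0..1}) R"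
    using assms(2) by (subst measurable_cong_sets[of _ borel _ "count_space UNIV"]) auto
  then show ?thesis
    using emeasure_PiM_fresh[where M = "\<lambda>_. uniform_measure lborel {0..1}" and Q = Q and R = R and i = i]
      prob_space_uniform assms(1) fresh
    unfolding uniform_field_def[symmetric] by (simp add: pred_def)
qed

text \<open>Each step consumes a uniform variable independent of the trajectory so far,
  \<open>U n\<close> on one side and that of a fresh arrow on the other, so both sides gain the same
  factor.\<close>

lemma emeasure_traj_eq:
  "emeasure uniform_field {U. traj \<omega> 0 U n = xs} =
   emeasure uniform_field {v. arrow_traj (\<lambda>i. v i < \<omega> i) n = xs}"
proof (induction n arbitrary: xs)
  case 0
  show ?case
    by (cases "xs = [0]") (auto simp: prob_space.emeasure_space_1[OF prob_space_uniform_field, simplified])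
next
  case (Suc n)
  note measurable_traj [measurable] measurable_threshold_arrows [measurable]
  show ?case
  proof (cases xs rule: rev_cases)
    case Nil
    then show ?thesis by (simp add: Let_def del: traj_neq_Nil)
  next
    case (snoc ys y)
    \<comment> \<open>Once the trajectory is fixed as \<open>ys\<close>, the arrow read next is
      determined.\<close>
    define i where "i = (last ys, count_list ys (last ys))"
    define R where "R u \<longleftrightarrow> (if u < \<omega> i then last ys + 1 else last ys - 1) = y" for u
    have [measurable]: "Measurable.pred borel R"
      unfolding R_def by measurable
    have "{U. traj \<omega> 0 U (Suc n) = xs} = {U. traj \<omega> 0 U n = ys \<and> R (U n)}"
      by (auto simp: Let_def snoc R_def i_def)
    also have "emeasure uniform_field \<dots> = emeasure uniform_field {U. traj \<omega> 0 U n = ys} *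
        emeasure (uniform_measure lborel {0..1}) {u. R u}"
    proof (rule emeasure_uniform_field_fresh)
      show "(traj \<omega> 0 (v(n := u)) n = ys) = (traj \<omega> 0 v n = ys)" for v u
        using traj_cong[of n "v(n := u)" v] by simp
    qed measurable
    also have "\<dots> = emeasure uniform_field {v. arrow_traj (\<lambda>i. v i < \<omega> i) n = ys} *
        emeasure (uniform_measure lborel {0..1}) {u. R u}"
      by (simp add: Suc)
    also have "\<dots> = emeasure uniform_field {v. arrow_traj (\<lambda>i. v i < \<omega> i) n = ys \<and> R (v i)}"
    proof -
      \<comment> \<open>Changing the variable of the next arrow leaves the trajectory alone, by
        \<open>arrow_traj_unread\<close>.\<close>
      have imp: "arrow_traj (\<lambda>i. w i < \<omega> i) n = ys"
        if "arrow_traj (\<lambda>i. v i < \<omega> i) n = ys" "\<And>j. j \<noteq> i \<Longrightarrow> v j = w j" for v w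
        using that arrow_traj_unread[of "\<lambda>i. v i < \<omega> i" n "\<lambda>i. w i < \<omega> i"]
        by (simp add: i_def pos_def visits_def)
      have fresh: "(arrow_traj (\<lambda>j. (v(i := u)) j < \<omega> j) n = ys) = (arrow_traj (\<lambda>j. v j < \<omega> j) n = ys)" for v u
      proof
        show "arrow_traj (\<lambda>j. v j < \<omega> j) n = ys" if "arrow_traj (\<lambda>j. (v(i := u)) j < \<omega> j) n = ys"
          by (rule imp[OF that]) simp
        show "arrow_traj (\<lambda>j. (v(i := u)) j < \<omega> j) n = ys" if "arrow_traj (\<lambda>j. v j < \<omega> j) n = ys"
          by (rule imp[OF that]) simp
      qed
      have "emeasure uniform_field {v. arrow_traj (\<lambda>i. v i < \<omega> i) n = ys \<and> R (v i)} =
          emeasure uniform_field {v. arrow_traj (\<lambda>i. v i < \<omega> i) n = ys} *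
          emeasure (uniform_measure lborel {0..1}) {u. R u}"
        by (rule emeasure_uniform_field_fresh) (measurable, rule fresh)
      then show ?thesis by (rule sym)
    qed
    also have "{v. arrow_traj (\<lambda>i. v i < \<omega> i) n = ys \<and> R (v i)} =
        {v. arrow_traj (\<lambda>i. v i < \<omega> i) (Suc n) = xs}"
      by (auto simp: Let_def snoc R_def i_def)
    finally show ?thesis .
  qed
qed

text \<open>Cylinder sets determine the law, and each of them is an event of the trajectory up to a
  finite time.\<close>

lemma distr_walk_eq:
  "distr unif_seq path_space (walk \<omega> 0) =
   distr uniform_field path_space (\<lambda>v. pos (\<lambda>i. v i < \<omega> i))"
proof (rule measure_eqI_PiM_infinite[where I = UNIV and M = "\<lambda>_. count_space UNIV"])
  note measurable_traj [measurable] measurable_walk [measurable] measurable_threshold_arrows [measurable]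
  let ?a = "\<lambda>v i. v i < \<omega> i"
  have [measurable]: "(\<lambda>v. pos (?a v)) \<in> measurable uniform_field path_space"
    unfolding path_space_def by (intro measurable_PiM_single') auto
  fix J :: "nat set" and B :: "nat \<Rightarrow> int set"
  assume J: "finite J"
  obtain n where n: "\<And>j. j \<in> J \<Longrightarrow> j \<le> n" using J by (meson finite_nat_set_iff_bounded_le)
  let ?C = "prod_emb UNIV (\<lambda>_. count_space UNIV) J (Pi\<^sub>E J B)"
  let ?L = "{xs. \<forall>j\<in>J. xs ! j \<in> B j}"
  have C: "?C = {X. \<forall>j\<in>J. X j \<in> B j}"
    by (auto simp: prod_emb_def PiE_iff)
  have "?C \<in> sets path_space"
    unfolding path_space_def using J by (intro sets_PiM_I) auto
  then have [measurable]: "{X. \<forall>j\<in>J. X j \<in> B j} \<in> sets path_space" unfolding C .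
  \<comment> \<open>Lists of integers are countable, so equality of the point masses is
    enough.\<close>
  have "distr uniform_field (count_space UNIV) (\<lambda>U. traj \<omega> 0 U n) =
      distr uniform_field (count_space UNIV) (\<lambda>v. arrow_traj (?a v) n)"
    by (rule measure_eqI_countable[where A = UNIV])
       (auto simp: emeasure_distr vimage_def emeasure_traj_eq)
  then have "emeasure (distr uniform_field (count_space UNIV) (\<lambda>U. traj \<omega> 0 U n)) ?L =
      emeasure (distr uniform_field (count_space UNIV) (\<lambda>v. arrow_traj (?a v) n)) ?L"
    by simp
  then show "emeasure (distr unif_seq path_space (walk \<omega> 0)) ?C =
      emeasure (distr uniform_field path_space (\<lambda>v. pos (?a v))) ?C"
    using n unfolding C by (simp add: emeasure_distr unif_seq_eq vimage_def walk_eq_nth[of _ n] pos_eq_nth[of _ n] cong: ball_cong)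
next
  show "finite_measure (distr unif_seq path_space (walk \<omega> 0))"
    using prob_space.finite_measure[OF prob_space_quenched] unfolding quenched_def .
qed (auto simp: path_space_def)

section \<open>The annealed law and the zero-one law\<close>

lemma sets_A_plus [measurable]: "A_plus \<in> sets path_space"
proof -
  have "{X \<in> space path_space. filterlim X at_top sequentially} \<in> sets path_space"
    unfolding filterlim_at_top eventually_sequentially path_space_def by measurable
  then show ?thesis by (simp add: A_plus_def path_space_def space_PiM)
qed

lemma sets_A_minus [measurable]: "A_minus \<in> sets path_space"
proof -
  have "{X \<in> space path_space. filterlim X at_bot sequentially} \<in> sets path_space"
    unfolding filterlim_at_bot eventually_sequentially path_space_def by measurable
  then show ?thesis by (simp add: A_minus_def path_space_def space_PiM)
qed

lemma (in cookie_environment) measurable_quenched [measurable]: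
  "(\<lambda>\<omega>. quenched \<omega> 0) \<in> measurable \<mu> (subprob_algebra path_space)"
proof -
  have traj: "(\<lambda>z. traj (fst z) 0 (snd z) n) \<in> measurable (\<mu> \<Otimes>\<^sub>M unif_seq) (count_space UNIV)" for n
  proof (induction n)
    case (Suc n)
    note Suc [measurable]
    have [measurable]: "(\<lambda>U. U i) \<in> borel_measurable unif_seq" for i
      unfolding unif_seq_eq by measurable
    show ?case unfolding traj.simps Let_def
      by (rule measurable_compose_countable[where g = "\<lambda>z. traj (fst z) 0 (snd z) n"]) measurable
  qed simp
  have "(\<lambda>z. walk (fst z) 0 (snd z)) \<in> measurable (\<mu> \<Otimes>\<^sub>M unif_seq) path_space"
    unfolding path_space_def walk_def[abs_def]
    by (intro measurable_PiM_single') (auto intro: measurable_compose[OF traj])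
  moreover have "(\<lambda>_. unif_seq) \<in> measurable \<mu> (subprob_algebra unif_seq)"
    unfolding unif_seq_eq
    by (intro measurable_const) (simp add: space_subprob_algebra prob_space_imp_subprob_space prob_space_uniform_field)
  ultimately show ?thesis
    unfolding quenched_def by (intro measurable_distr2) (auto simp: case_prod_beta')
qed

text \<open>The annealed law disintegrates into quenched laws, which are laws of arrow walks;
  Fubini's theorem reassembles these on the joint space.\<close>

lemma (in cookie_environment) AE_annealed_iff:
  assumes [measurable]: "A \<in> sets path_space"
  shows "(AE X in annealed \<mu> 0. X \<in> A) \<longleftrightarrow> (AE z in joint. pos (arrows 1 z) \<in> A)"
proof -
  note measurable_threshold_arrows [measurable]
  have arrows: "arrows 1 z = (\<lambda>i. snd z i < fst z i)" for z
    by (simp add: arrows_def orient_def fun_eq_iff)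
  have [measurable]: "(\<lambda>a. pos a) \<in> measurable arrow_space path_space"
    unfolding path_space_def by (intro measurable_PiM_single') auto
  have [measurable]: "Measurable.pred path_space (\<lambda>X. X \<in> A)" by measurable
  have "(AE X in annealed \<mu> 0. X \<in> A) \<longleftrightarrow> (AE \<omega> in \<mu>. AE X in quenched \<omega> 0. X \<in> A)"
    unfolding annealed_def by (rule AE_bind) measurable
  also have "\<dots> \<longleftrightarrow> (AE \<omega> in \<mu>. AE v in uniform_field. pos (\<lambda>i. v i < \<omega> i) \<in> A)"
    unfolding quenched_def distr_walk_eq by (intro AE_cong AE_distr_iff) auto
  also have "\<dots> \<longleftrightarrow> (AE z in joint. pos (arrows 1 z) \<in> A)"
  proof -
    have "{z \<in> space joint. pos (arrows 1 z) \<in> A} \<in> sets joint" by measurable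
    then show ?thesis
      using joint.AE_pair_iff[of "\<lambda>\<omega> v. pos (arrows 1 (\<omega>, v)) \<in> A"] by (simp add: arrows)
  qed
  finally show ?thesis .
qed

theorem theorem3p1:
  fixes \<mu> :: "env measure"
  assumes "prob_space \<mu>"
    and "sets \<mu> = sets cookie_space"
    and "stationary \<mu>"
    and "ergodic \<mu>"
    and "elliptic \<mu>"
  shows "measure (annealed \<mu> 0) (A_plus \<union> A_minus) \<in> {0, 1}"
proof -
  interpret cookie_environment \<mu>
    using assms by (simp add: cookie_environment_def cookie_environment_axioms_def)
  let ?A = "A_plus \<union> A_minus"
  interpret Q: prob_space "annealed \<mu> 0"
    unfolding annealed_def
  proof (rule prob_space_bind[OF _ measurable_quenched])
    show "AE \<omega> in \<mu>. prob_space (quenched \<omega> 0)"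
      by (simp add: prob_space_quenched)
  qed
  have sets: "sets (annealed \<mu> 0) = sets path_space"
    unfolding annealed_def by (rule sets_bind[OF sets_kernel[OF measurable_quenched]]) (auto simp: not_empty)
  have space: "space path_space = UNIV" by (simp add: path_space_def space_PiM)
  have plus: "pos a \<in> A_plus \<longleftrightarrow> escapes a" for a
    by (simp add: A_plus_def escapes_def)
  have minus: "pos a \<in> A_minus \<longleftrightarrow> escapes (orient (-1) a)" for a
    unfolding A_minus_def escapes_def mem_Collect_eq pos_orient_minus[abs_def] filterlim_at_top filterlim_at_bot
      le_minus_iff[of _ "pos a _"] by (metis minus_minus)
  \<comment> \<open>Reflection is an involution, so the dichotomy for \<open>s = -1\<close> is the
    one for \<open>s = 1\<close> with the two escapes exchanged.\<close>
  have opp: "arrows (-1) z = orient (-1) (arrows 1 z)" "orient (-1) (orient (-1) a) = a" for z a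
    by (auto simp: arrows_def orient_def)
  \<comment> \<open>Either both escapes are null, or one has positive probability and the dichotomy
    in its direction makes the walk almost surely transient.\<close>
  show ?thesis
  proof (cases "(AE z in joint. \<not> escapes (arrows 1 z)) \<and> (AE z in joint. \<not> escapes (arrows (-1) z))")
    case True
    then have "AE z in joint. pos (arrows 1 z) \<in> - ?A"
      by (auto simp: plus minus opp)
    then have "AE X in annealed \<mu> 0. X \<in> - ?A"
      using AE_annealed_iff[of "- ?A"] sets.compl_sets[of ?A path_space] by (simp add: space Compl_eq_Diff_UNIV)
    then have "Q.prob ?A = 0"
      by (subst Q.prob_eq_0) (auto simp: sets)
    then show ?thesis by simp
  next
    case False
    then have "AE z in joint. escapes (arrows 1 z) \<or> escapes (arrows (-1) z)"
      using escape_dichotomy[of 1] escape_dichotomy[of "-1"] by (auto simp: opp disj_commute)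
    then have "AE z in joint. pos (arrows 1 z) \<in> ?A"
      by (simp add: plus minus opp)
    then have "AE X in annealed \<mu> 0. X \<in> ?A"
      using AE_annealed_iff[of ?A] by simp
    then have "Q.prob ?A = 1"
      by (subst Q.prob_eq_1) (auto simp: sets)
    then show ?thesis by simp
  qed
qed

end
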